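(* Finite extensions of graph automatic groups are graph automatic: if $H$ is a graph automatic group and $H$ is a normal subgroup of a group $G$ such that the quotient $G/H$ is finite, then $G$ is graph automatic.
   Context: For a finite alphabet $\Sigma$, let $\Sigma^\star$ be the set of finite strings over $\Sigma$. For strings $w_1,\dots,w_n\in\Sigma^\star$ the convolution $\otimes(w_1,\dots,w_n)$ is the string of length $\max_i|w_i|$ over the alphabet $(\Sigma\cup\{\diamond\})^n$ (with $\diamond\notin\Sigma$) whose $k$-th symbol is $(\sigma_1,\dots,\sigma_n)$, where $\sigma_i$ is the $k$-th symbol of $w_i$ if $k\le|w_i|$ and $\sigma_i=\diamond$ otherwise. A relation $R\subseteq(\Sigma^\star)^n$ is FA recognizable if $\{\otimes(w_1,\dots,w_n)\mid (w_1,\dots,w_n)\in R\}$ is a regular language (recognized by a finite automaton). Let $G$ be a group generated by a finite set $X$. Its Cayley graph $\Gamma(G,X)$ is viewed as the structure $(G;(E_x)_{x\in X})$ with $E_x=\{(g,gx)\mid g\in G\}$. The group $G$ is graph automatic with respect to $X$ if there are a finite alphabet $\Sigma$, a regular language $R\subseteq\Sigma^\star$ and a bijection $\nu:R\to G$ such that for each $x\in X$ the relation $\{(u,v)\in R^2\mid \nu(u)x=\nu(v)\}$ is FA recognizable. A finitely generated group is graph automatic if it is graph automatic with respect to some finite generating set. *)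

theory Defs
  imports "HOL-Algebra.Generated_Groups"
begin

record ('q, 'a) automaton =
  states :: "'q set"
  initial :: "'q set"
  trans_rel :: "('q \<times> 'a \<times> 'q) set"
  final :: "'q set"

definition finite_automaton :: "'a set \<Rightarrow> ('q, 'a) automaton \<Rightarrow> bool" where
  "finite_automaton \<Sigma> M \<longleftrightarrow>
     finite \<Sigma> \<and> finite (states M) \<and> initial M \<subseteq> states M \<and> final M \<subseteq> states M \<and>
     trans_rel M \<subseteq> states M \<times> \<Sigma> \<times> states M"

fun has_run :: "('q, 'a) automaton \<Rightarrow> 'q \<Rightarrow> 'a list \<Rightarrow> 'q \<Rightarrow> bool" where
  "has_run M p [] q \<longleftrightarrow> p = q"
| "has_run M p (a # w) q \<longleftrightarrow> (\<exists>r. (p, a, r) \<in> trans_rel M \<and> has_run M r w q)"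

definition language :: "'a set \<Rightarrow> ('q, 'a) automaton \<Rightarrow> 'a list set" where
  "language \<Sigma> M = {w \<in> lists \<Sigma>. \<exists>p \<in> initial M. \<exists>q \<in> final M. has_run M p w q}"

text \<open>Automata are nondeterministic. Their states are natural numbers, which is no restriction
  as every finite set of states can be renamed into the natural numbers.\<close>

definition regular :: "'a set \<Rightarrow> 'a list set \<Rightarrow> bool" where
  "regular \<Sigma> L \<longleftrightarrow> (\<exists>M :: (nat, 'a) automaton. finite_automaton \<Sigma> M \<and> language \<Sigma> M = L)"

text \<open>An \<open>n\<close>-tuple of strings is a list of length \<open>n\<close>, and so is a symbol of a convolution. The
  padding symbol is \<^const>\<open>None\<close>. The inserted \<open>0\<close> matters only for the empty tuple.\<close>

definition convolution :: "'a list list \<Rightarrow> 'a option list list" where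
  "convolution ws =
     map (\<lambda>k. map (\<lambda>w. if k < length w then Some (w ! k) else None) ws)
       [0..<Max (insert 0 (length ` set ws))]"

definition tuples :: "nat \<Rightarrow> 'b set \<Rightarrow> 'b list set" where
  "tuples n A = {xs \<in> lists A. length xs = n}"

definition FA_recognizable :: "nat \<Rightarrow> 'a set \<Rightarrow> 'a list list set \<Rightarrow> bool" where
  "FA_recognizable n \<Sigma> R \<longleftrightarrow>
     R \<subseteq> tuples n (lists \<Sigma>) \<and>
     regular (tuples n (insert None (Some ` \<Sigma>))) (convolution ` R)"

definition finite_generating_set :: "('g, 'm) monoid_scheme \<Rightarrow> 'g set \<Rightarrow> bool" where
  "finite_generating_set G X \<longleftrightarrow> finite X \<and> X \<subseteq> carrier G \<and> generate G X = carrier G"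

definition cayley_edges :: "('g, 'm) monoid_scheme \<Rightarrow> 'g \<Rightarrow> ('g \<times> 'g) set" where
  "cayley_edges G x = {(g, g \<otimes>\<^bsub>G\<^esub> x) | g. g \<in> carrier G}"

text \<open>The relation required to be FA recognizable is
  \<open>{(u, v) \<in> R\<^sup>2. \<nu>(u) x = \<nu>(v)}\<close>. Finite alphabets are taken among sets of natural numbers,
  which is no restriction up to renaming of symbols.\<close>

definition graph_automatic_wrt :: "('g, 'm) monoid_scheme \<Rightarrow> 'g set \<Rightarrow> bool" where
  "graph_automatic_wrt G X \<longleftrightarrow>
     group G \<and> finite_generating_set G X \<and>
     (\<exists>(\<Sigma> :: nat set) R \<nu>.
        finite \<Sigma> \<and> regular \<Sigma> R \<and> bij_betw \<nu> R (carrier G) \<and>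
        (\<forall>x \<in> X. FA_recognizable 2 \<Sigma>
           {[u, v] | u v. u \<in> R \<and> v \<in> R \<and> (\<nu> u, \<nu> v) \<in> cayley_edges G x}))"

definition graph_automatic :: "('g, 'm) monoid_scheme \<Rightarrow> bool" where
  "graph_automatic G \<longleftrightarrow> (\<exists>X. graph_automatic_wrt G X)"

end

theory Submission
  imports Defs
begin

text \<open>Write every element of \<open>G\<close> uniquely as \<open>h k\<^sub>i\<close> with \<open>h \<in> H\<close> and \<open>k\<^sub>i\<close> one of finitely
  many representatives of the right cosets, and encode it by the letter \<open>i\<close> followed by the code
  of \<open>h\<close>. If \<open>k\<^sub>i y = h\<^sub>i k\<^sub>j\<close>, then \<open>h k\<^sub>i y = (h h\<^sub>i) k\<^sub>j\<close>, so right multiplication by \<open>y\<close>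
  changes the first letter and multiplies the \<open>H\<close>-part on the right by one of finitely many fixed
  elements. The latter is FA recognizable because FA recognizable binary relations are closed under
  identity, converse and composition. Regularity is handled through the Myhill--Nerode criterion
  that a language has finitely many left quotients.\<close>

section \<open>Left quotients and regularity\<close>

definition left_quotient :: "'a list \<Rightarrow> 'a list set \<Rightarrow> 'a list set" where
  "left_quotient w L = {v. w @ v \<in> L}"

text \<open>The words \<open>w\<close> range over all lists, so no alphabet is mentioned and the
  closure proofs need not carry one along.\<close>

definition finite_quotients :: "'a list set \<Rightarrow> bool" where
  "finite_quotients L \<longleftrightarrow> finite (range (\<lambda>w. left_quotient w L))"

lemma left_quotient_Nil [simp]: "left_quotient [] L = L"
  by (simp add: left_quotient_def)

lemma left_quotient_append: "left_quotient (u @ v) L = left_quotient v (left_quotient u L)"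
  by (simp add: left_quotient_def)

lemma finite_quotientsI:
  assumes "finite F" "\<And>w. left_quotient w L \<in> F"
  shows "finite_quotients L"
  unfolding finite_quotients_def using assms by (auto intro: finite_subset)

lemma has_run_append:
  "has_run M p (u @ v) q \<longleftrightarrow> (\<exists>r. has_run M p u r \<and> has_run M r v q)"
  by (induction u arbitrary: p) auto

lemma has_run_states:
  assumes "finite_automaton \<Sigma> M" "has_run M p w q" "p \<in> states M"
  shows "q \<in> states M"
  using assms(2,3)
proof (induction w arbitrary: p)
  case (Cons a w)
  then show ?case using assms(1) unfolding finite_automaton_def by auto
qed simp

text \<open>The quotient by \<open>w\<close> depends only on the set of states reachable by reading
  \<open>w\<close>, and there are finitely many such sets. A word with a letter outside
  \<open>\<Sigma>\<close> has the empty quotient.\<close>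

lemma regular_imp_finite_quotients:
  assumes "regular \<Sigma> L"
  shows "finite_quotients L"
proof -
  obtain M :: "(nat, 'a) automaton"
    where M: "finite_automaton \<Sigma> M" and L: "L = language \<Sigma> M"
    using assms by (auto simp: regular_def)
  \<comment> \<open>\<open>F S\<close> is the language accepted when the runs start in the set
    \<open>S\<close>.\<close>
  define F where "F S = {v \<in> lists \<Sigma>. \<exists>p\<in>S. \<exists>q\<in>final M. has_run M p v q}" for S
  show ?thesis
  proof (rule finite_quotientsI)
    show "finite (insert {} (F ` Pow (states M)))"
      using M by (simp add: finite_automaton_def)
    fix w
    show "left_quotient w L \<in> insert {} (F ` Pow (states M))"
    proof (cases "w \<in> lists \<Sigma>")
      case True
      define S where "S = {r. \<exists>p\<in>initial M. has_run M p w r}"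
      have "S \<subseteq> states M"
        using M has_run_states[OF M] by (auto simp: S_def finite_automaton_def)
      moreover have "left_quotient w L = F S"
        using True by (auto simp: left_quotient_def L language_def F_def S_def has_run_append)
      ultimately show ?thesis by blast
    next
      case False
      then have "left_quotient w L = {}"
        by (auto simp: left_quotient_def L language_def)
      then show ?thesis by simp
    qed
  qed
qed

text \<open>Nerode automaton: the states are the quotients of \<open>L\<close>, the letter
  \<open>a\<close> leads from \<open>D\<close> to \<open>left_quotient [a] D\<close>, and the
  quotients containing the empty word are final.\<close>

lemma finite_quotients_imp_regular:
  assumes fin: "finite \<Sigma>" and sub: "L \<subseteq> lists \<Sigma>" and fq: "finite_quotients L"
  shows "regular \<Sigma> L"
proof -
  define Q where "Q = range (\<lambda>w. left_quotient w L)"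
  have finQ: "finite Q" using fq by (simp add: Q_def finite_quotients_def)
  \<comment> \<open>\<open>f\<close> renames the quotients into natural numbers, the state type that
    \<open>regular\<close> asks for.\<close>
  obtain f :: "'a list set \<Rightarrow> nat" where inj: "inj_on f Q"
    using finite_imp_inj_to_nat_seg[OF finQ] by blast
  have LQ: "L \<in> Q" unfolding Q_def by (metis left_quotient_Nil rangeI)
  have stepQ: "left_quotient w D \<in> Q" if "D \<in> Q" for w D
    using that unfolding Q_def by (auto simp: left_quotient_append[symmetric])
  define M :: "(nat, 'a) automaton" where
    "M = \<lparr>states = f ` Q, initial = {f L},
          trans_rel = {(f D, a, f (left_quotient [a] D)) | D a. D \<in> Q \<and> a \<in> \<Sigma>},
          final = f ` {D \<in> Q. [] \<in> D}\<rparr>"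
  \<comment> \<open>Injectivity of \<open>f\<close> on \<open>Q\<close> makes \<open>M\<close>
    deterministic, so the end of a run is a function of its start and the word read.\<close>
  have run: "has_run M (f D) w q \<longleftrightarrow> q = f (left_quotient w D)"
    if "D \<in> Q" "w \<in> lists \<Sigma>" for D w q
    using that
  proof (induction w arbitrary: D)
    case (Cons a w)
    have "(f D, a, r) \<in> trans_rel M \<longleftrightarrow> r = f (left_quotient [a] D)" for r
      using Cons.prems inj by (auto simp: M_def dest: inj_onD)
    then have "has_run M (f D) (a # w) q \<longleftrightarrow> has_run M (f (left_quotient [a] D)) w q"
      by simp
    also have "\<dots> \<longleftrightarrow> q = f (left_quotient w (left_quotient [a] D))"
      using Cons stepQ by simp
    finally show ?case by (simp flip: left_quotient_append)
  qed auto
  have fa: "finite_automaton \<Sigma> M"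
    using fin finQ LQ stepQ by (auto simp: finite_automaton_def M_def)
  have "w \<in> language \<Sigma> M \<longleftrightarrow> w \<in> L" if w: "w \<in> lists \<Sigma>" for w
  proof -
    have "w \<in> language \<Sigma> M \<longleftrightarrow> f (left_quotient w L) \<in> f ` {D \<in> Q. [] \<in> D}"
      using w run[OF LQ w] by (auto simp: language_def) (auto simp: M_def run LQ)
    also have "\<dots> \<longleftrightarrow> [] \<in> left_quotient w L"
      using inj stepQ[OF LQ] by (auto dest: inj_onD)
    finally show ?thesis by (simp add: left_quotient_def)
  qed
  moreover have "language \<Sigma> M \<subseteq> lists \<Sigma>"
    by (auto simp: language_def)
  ultimately have "language \<Sigma> M = L"
    using sub by blast
  with fa show ?thesis by (auto simp: regular_def)
qed

lemma regular_iff_finite_quotients: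
  assumes "finite \<Sigma>"
  shows "regular \<Sigma> L \<longleftrightarrow> L \<subseteq> lists \<Sigma> \<and> finite_quotients L"
proof -
  have "L \<subseteq> lists \<Sigma>" if "regular \<Sigma> L"
    using that by (auto simp: regular_def language_def)
  then show ?thesis
    using assms finite_quotients_imp_regular regular_imp_finite_quotients by metis
qed

section \<open>Closure properties\<close>

lemma finite_quotients_empty: "finite_quotients {}"
  by (rule finite_quotientsI[of "{{}}"]) (auto simp: left_quotient_def)

lemma finite_quotients_Un:
  assumes "finite_quotients L" "finite_quotients M"
  shows "finite_quotients (L \<union> M)"
proof (rule finite_quotientsI)
  let ?F = "(\<lambda>(A, B). A \<union> B) ` (range (\<lambda>w. left_quotient w L) \<times> range (\<lambda>w. left_quotient w M))"
  show "finite ?F" using assms by (simp add: finite_quotients_def)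
  show "left_quotient w (L \<union> M) \<in> ?F" for w
    by (rule image_eqI[of _ _ "(left_quotient w L, left_quotient w M)"])
      (auto simp: left_quotient_def)
qed

lemma finite_quotients_Int:
  assumes "finite_quotients L" "finite_quotients M"
  shows "finite_quotients (L \<inter> M)"
proof (rule finite_quotientsI)
  let ?F = "(\<lambda>(A, B). A \<inter> B) ` (range (\<lambda>w. left_quotient w L) \<times> range (\<lambda>w. left_quotient w M))"
  show "finite ?F" using assms by (simp add: finite_quotients_def)
  show "left_quotient w (L \<inter> M) \<in> ?F" for w
    by (rule image_eqI[of _ _ "(left_quotient w L, left_quotient w M)"])
      (auto simp: left_quotient_def)
qed

lemma finite_quotients_UN:
  assumes "finite I" "\<And>i. i \<in> I \<Longrightarrow> finite_quotients (L i)"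
  shows "finite_quotients (\<Union>i\<in>I. L i)"
  using assms by (induction I rule: finite_induct)
    (auto simp: finite_quotients_empty finite_quotients_Un)

lemma finite_quotients_Cons:
  assumes "finite_quotients L"
  shows "finite_quotients ((#) a ` L)"
proof (rule finite_quotientsI)
  let ?F = "insert ((#) a ` L) (insert {} (range (\<lambda>w. left_quotient w L)))"
  show "finite ?F" using assms by (simp add: finite_quotients_def)
  show "left_quotient w ((#) a ` L) \<in> ?F" for w
  proof (cases w)
    case (Cons b v)
    then have "left_quotient w ((#) a ` L) = (if b = a then left_quotient v L else {})"
      by (auto simp: left_quotient_def)
    then show ?thesis by auto
  qed simp
qed

text \<open>Taking the preimage under a letter map commutes with quotients, once \<open>w\<close> is
  replaced by \<open>map f w\<close>.\<close>

lemma finite_quotients_map_vimage: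
  assumes "finite_quotients L"
  shows "finite_quotients (map f -` L)"
proof (rule finite_quotientsI)
  show "finite ((\<lambda>D. map f -` D) ` range (\<lambda>w. left_quotient w L))"
    using assms by (simp add: finite_quotients_def)
  fix w
  have "left_quotient w (map f -` L) = map f -` left_quotient (map f w) L"
    by (auto simp: left_quotient_def)
  then show "left_quotient w (map f -` L)
      \<in> (\<lambda>D. map f -` D) ` range (\<lambda>w. left_quotient w L)"
    by (rule image_eqI) (rule rangeI)
qed

text \<open>This is the subset construction for a projection: the quotient by \<open>w\<close> is
  the union of the images of the quotients by all \<open>t\<close> with \<open>map f t = w\<close>,
  so it is given by a subset of the finite set of quotients of \<open>L\<close>.\<close>

lemma finite_quotients_map_image:
  assumes "finite_quotients L"
  shows "finite_quotients (map f ` L)"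
proof (rule finite_quotientsI)
  let ?F = "(\<lambda>S. \<Union>D\<in>S. map f ` D) ` Pow (range (\<lambda>w. left_quotient w L))"
  show "finite ?F" using assms by (simp add: finite_quotients_def)
  fix w
  have "left_quotient w (map f ` L) = (\<Union>D\<in>{left_quotient t L | t. map f t = w}. map f ` D)"
  proof (intro equalityI subsetI)
    fix v assume "v \<in> left_quotient w (map f ` L)"
    then obtain s where s: "s \<in> L" "map f s = w @ v"
      by (auto simp: left_quotient_def)
    then obtain t t' where "s = t @ t'" "map f t = w" "map f t' = v"
      by (auto simp: map_eq_append_conv)
    with s show "v \<in> (\<Union>D\<in>{left_quotient t L | t. map f t = w}. map f ` D)"
      by (auto simp: left_quotient_def)
  next
    fix v assume "v \<in> (\<Union>D\<in>{left_quotient t L | t. map f t = w}. map f ` D)"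
    then obtain t t' where "map f t = w" "t @ t' \<in> L" "v = map f t'"
      by (auto simp: left_quotient_def)
    then show "v \<in> left_quotient w (map f ` L)"
      by (auto simp: left_quotient_def intro!: image_eqI[of _ _ "t @ t'"])
  qed
  then show "left_quotient w (map f ` L) \<in> ?F"
    by (rule image_eqI) auto
qed

section \<open>Trailing padding\<close>

definition pad_right :: "'a \<Rightarrow> 'a list set \<Rightarrow> 'a list set" where
  "pad_right p L = {x @ replicate k p | x k. x \<in> L}"

text \<open>The condition on \<open>last x\<close> forces every trailing \<open>p\<close> to be
  removed, so each word of \<open>L\<close> contributes exactly one \<open>x\<close>.\<close>

definition strip_right :: "'a \<Rightarrow> 'a list set \<Rightarrow> 'a list set" where
  "strip_right p L = {x. (x \<noteq> [] \<longrightarrow> last x \<noteq> p) \<and> (\<exists>k. x @ replicate k p \<in> L)}"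

text \<open>After reading \<open>w\<close>, either a word of \<open>L\<close> is still to be
  completed and then padded, or the padding has begun and only copies of \<open>p\<close> may
  follow. The quotient is thus determined by a quotient of \<open>L\<close> and one bit.\<close>

lemma finite_quotients_pad_right:
  assumes "finite_quotients L"
  shows "finite_quotients (pad_right p L)"
proof (rule finite_quotientsI)
  let ?P = "range (\<lambda>k. replicate k p)"
  let ?F = "(\<lambda>(D, b). pad_right p D \<union> (if b then ?P else {})) `
    (range (\<lambda>w. left_quotient w L) \<times> UNIV)"
  show "finite ?F" using assms by (simp add: finite_quotients_def)
  fix w
  have "left_quotient w (pad_right p L) =
      pad_right p (left_quotient w L) \<union> (if w \<in> pad_right p L then ?P else {})"
  proof (intro equalityI subsetI)
    fix v assume "v \<in> left_quotient w (pad_right p L)"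
    then obtain x k where x: "x \<in> L" and "w @ v = x @ replicate k p"
      by (auto simp: left_quotient_def pad_right_def)
    \<comment> \<open>The cut between \<open>w\<close> and \<open>v\<close> falls inside
      \<open>x\<close> or inside the padding.\<close>
    then consider us where "w @ us = x" "v = us @ replicate k p"
      | us where "w = x @ us" "us @ v = replicate k p"
      by (metis append_eq_append_conv2)
    then show "v \<in> pad_right p (left_quotient w L) \<union> (if w \<in> pad_right p L then ?P else {})"
    proof cases
      case 1
      with x show ?thesis by (auto simp: pad_right_def left_quotient_def)
    next
      case 2
      then have "us = replicate (length us) p" "v = replicate (length v) p"
        by (metis append_eq_conv_conj length_append length_replicate replicate_eqI
            in_set_conv_decomp in_set_replicate Un_iff set_append)+
      with 2 x have "w \<in> pad_right p L" "v \<in> ?P" unfolding pad_right_def by blast+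
      then show ?thesis by simp
    qed
  next
    fix v assume "v \<in> pad_right p (left_quotient w L) \<union> (if w \<in> pad_right p L then ?P else {})"
    then consider "v \<in> pad_right p (left_quotient w L)" | "w \<in> pad_right p L" "v \<in> ?P"
      by (auto split: if_splits)
    then show "v \<in> left_quotient w (pad_right p L)"
    proof cases
      case 1
      then show ?thesis
        by (auto simp: pad_right_def left_quotient_def) (metis append.assoc)
    next
      case 2
      then obtain x j k where "x \<in> L" "w = x @ replicate j p" "v = replicate k p"
        by (auto simp: pad_right_def)
      then have "w @ v = x @ replicate (j + k) p" "x \<in> L"
        by (simp_all add: replicate_add)
      then show ?thesis
        unfolding pad_right_def left_quotient_def by blast
    qed
  qed
  then show "left_quotient w (pad_right p L) \<in> ?F"
    by (intro image_eqI[of _ _ "(left_quotient w L, w \<in> pad_right p L)"]) auto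
qed

lemma finite_quotients_strip_right:
  assumes "finite_quotients L"
  shows "finite_quotients (strip_right p L)"
proof -
  define E where "E = {x. x \<noteq> [] \<longrightarrow> last x \<noteq> p}"
  define S where "S K = {x. \<exists>k. x @ replicate k p \<in> K}" for K
  have "finite_quotients E"
  proof (rule finite_quotientsI)
    \<comment> \<open>The bit \<open>b\<close> records whether \<open>w\<close> itself lies in
      \<open>E\<close>. It matters only for the empty continuation, since otherwise the last letter
      of \<open>v\<close> decides.\<close>
    let ?F = "(\<lambda>b. {v. if v = [] then b else last v \<noteq> p}) ` (UNIV :: bool set)"
    show "finite ?F" by simp
    show "left_quotient w E \<in> ?F" for w
      by (rule image_eqI[of _ _ "w \<noteq> [] \<longrightarrow> last w \<noteq> p"])
        (auto simp: left_quotient_def E_def last_append)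
  qed
  moreover have "finite_quotients (S L)"
  proof (rule finite_quotientsI)
    show "finite (S ` range (\<lambda>w. left_quotient w L))"
      using assms by (simp add: finite_quotients_def)
    fix w
    \<comment> \<open>\<open>S\<close> acts at the right end of words and quotients act at the left
      end, so the two operations commute.\<close>
    have "left_quotient w (S L) = S (left_quotient w L)"
      by (auto simp: left_quotient_def S_def)
    then show "left_quotient w (S L) \<in> S ` range (\<lambda>w. left_quotient w L)" by blast
  qed
  moreover have "strip_right p L = E \<inter> S L"
    by (auto simp: strip_right_def E_def S_def)
  ultimately show ?thesis by (simp add: finite_quotients_Int)
qed

section \<open>Convolutions of two strings\<close>

abbreviation padded_nth :: "'a list \<Rightarrow> nat \<Rightarrow> 'a option" where
  "padded_nth w k \<equiv> (if k < length w then Some (w ! k) else None)"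

text \<open>The positions that carry \<open>Some\<close> determine the length, and their contents
  the letters.\<close>

lemma padded_nth_inject:
  assumes "\<And>k. padded_nth u k = padded_nth v k"
  shows "u = v"
proof (rule nth_equalityI)
  have "k < length u \<longleftrightarrow> k < length v" for k
    using assms[of k] by (auto split: if_splits)
  then show "length u = length v" by (metis linorder_neq_iff)
  show "u ! k = v ! k" if "k < length u" for k
    using assms[of k] that by (auto split: if_splits)
qed

lemma convolution2:
  "convolution [u, v] =
    map (\<lambda>k. [padded_nth u k, padded_nth v k]) [0..<max (length u) (length v)]"
  by (simp add: convolution_def)

text \<open>This lets convolutions of different lengths be compared at one common length
  \<open>N\<close>.\<close>

lemma convolution2_pad:
  assumes "max (length u) (length v) \<le> N"
  shows "map (\<lambda>k. [padded_nth u k, padded_nth v k]) [0..<N] =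
    convolution [u, v] @ replicate (N - max (length u) (length v)) [None, None]"
  using assms
  by (intro nth_equalityI) (auto simp: convolution2 nth_append)

lemma last_convolution2:
  assumes "convolution [u, v] \<noteq> []"
  shows "last (convolution [u, v]) \<noteq> [None, None]"
proof -
  have "max (length u) (length v) \<noteq> 0"
    using assms by (auto simp: convolution2)
  then show ?thesis
    by (auto simp: convolution2 last_map max_def split: if_splits)
qed

lemma convolution2_Cons:
  "convolution [a # u, b # v] = [Some a, Some b] # convolution [u, v]"
  by (simp add: convolution2 upt_conv_Cons map_Suc_upt[symmetric] comp_def del: upt_Suc)

text \<open>On symbols of length two \<open>rev\<close> exchanges the tracks.\<close>

lemma convolution2_swap: "convolution [v, u] = map rev (convolution [u, v])"
  by (simp add: convolution2 max.commute)

lemma convolution2_diag: "convolution [u, u] = map (\<lambda>a. [Some a, Some a]) u"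
  by (intro nth_equalityI) (auto simp: convolution2)

lemma convolution2_in_lists:
  assumes "u \<in> lists \<Sigma>" "v \<in> lists \<Sigma>"
  shows "convolution [u, v] \<in> lists (tuples 2 (insert None (Some ` \<Sigma>)))"
proof -
  have "padded_nth w i \<in> insert None (Some ` \<Sigma>)" if "w \<in> lists \<Sigma>" for w i
    using that by (auto simp: in_lists_conv_set)
  then show ?thesis
    using assms by (auto simp: convolution2 tuples_def in_lists_conv_set simp del: insert_iff)
qed

text \<open>Reversing the padded word and dropping the leading copies of \<open>p\<close> recovers
  the reversal of \<open>x\<close>, whatever the amount of padding.\<close>

lemma append_replicate_inject:
  assumes "x @ replicate k p = y @ replicate m p"
    and "x \<noteq> [] \<longrightarrow> last x \<noteq> p" "y \<noteq> [] \<longrightarrow> last y \<noteq> p"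
  shows "x = y"
proof -
  have "dropWhile ((=) p) (rev (z @ replicate n p)) = rev z"
    if "z \<noteq> [] \<longrightarrow> last z \<noteq> p" for z n
  proof -
    have "dropWhile ((=) p) (replicate n p @ zs) = dropWhile ((=) p) zs" for zs
      by (induction n) auto
    then show ?thesis using that by (cases z rule: rev_cases) auto
  qed
  then show ?thesis using assms by (metis rev_rev_ident)
qed

text \<open>In the composition the middle string may be longer than the two outer ones. So the languages
  of both factors are first padded, and the superfluous padding of the outer strings is stripped
  after projecting away the middle track.\<close>

lemma convolution_relcomp:
  defines "C \<equiv> (\<lambda>A. (\<lambda>(u, v). convolution [u, v]) ` A)"
  defines "P \<equiv> pad_right [None, None]"
  shows "C (A O B) = strip_right [None, None] (map (\<lambda>(a, b, c). [a, c]) `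
    (map (\<lambda>(a, b, c). [a, b]) -` P (C A) \<inter> map (\<lambda>(a, b, c). [b, c]) -` P (C B)))"
    (is "_ = strip_right _ (map ?ac ` (map ?ab -` _ \<inter> map ?bc -` _))")
proof -
  \<comment> \<open>A padded convolution is the two-track word of a pair, written out at any length
    that covers both strings.\<close>
  have P_iff: "y \<in> P (C E) \<longleftrightarrow> (\<exists>u v. (u, v) \<in> E \<and> max (length u) (length v) \<le> length y \<and>
      y = map (\<lambda>k. [padded_nth u k, padded_nth v k]) [0..<length y])" (is "_ \<longleftrightarrow> ?rhs") for y E
  proof
    assume "y \<in> P (C E)"
    then obtain u v k where uv: "(u, v) \<in> E"
      and y: "y = convolution [u, v] @ replicate k [None, None]"
      by (auto simp: P_def C_def pad_right_def)
    have len: "length y = max (length u) (length v) + k" by (simp add: y convolution2)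
    have "map (\<lambda>k. [padded_nth u k, padded_nth v k]) [0..<length y] =
        convolution [u, v] @ replicate k [None, None]"
      using convolution2_pad[of u v "length y"] len by simp
    from y[folded this] have "y = map (\<lambda>k. [padded_nth u k, padded_nth v k]) [0..<length y]" .
    moreover have "max (length u) (length v) \<le> length y" using len by simp
    ultimately show ?rhs using uv by blast
  next
    assume ?rhs
    then obtain u v where "(u, v) \<in> E" and le: "max (length u) (length v) \<le> length y"
      and "y = map (\<lambda>k. [padded_nth u k, padded_nth v k]) [0..<length y]"
      by blast
    with convolution2_pad[OF le] show "y \<in> P (C E)"
      unfolding P_def C_def pad_right_def by auto
  qed
  show ?thesis
  proof (intro equalityI subsetI)
    fix x assume "x \<in> C (A O B)"
    then obtain u v w where uv: "(u, v) \<in> A" and vw: "(v, w) \<in> B"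
      and x: "x = convolution [u, w]"
      by (auto simp: C_def)
    \<comment> \<open>\<open>N\<close> covers all three strings. The projections of the three-track
      word \<open>t\<close> are padded convolutions of \<open>(u, v)\<close>, \<open>(v, w)\<close>
      and \<open>(u, w)\<close>.\<close>
    define N where "N = max (length u) (max (length v) (length w))"
    define t where "t = map (\<lambda>k. (padded_nth u k, padded_nth v k, padded_nth w k)) [0..<N]"
    have "map ?ab t \<in> P (C A)" unfolding P_iff
      by (rule exI[of _ u], rule exI[of _ v]) (use uv in \<open>simp add: t_def N_def\<close>)
    moreover have "map ?bc t \<in> P (C B)" unfolding P_iff
      by (rule exI[of _ v], rule exI[of _ w]) (use vw in \<open>simp add: t_def N_def\<close>)
    moreover have "map ?ac t = x @ replicate (N - max (length u) (length w)) [None, None]"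
      using convolution2_pad[of u w N] by (simp add: t_def N_def x comp_def)
    ultimately have "x @ replicate (N - max (length u) (length w)) [None, None]
        \<in> map ?ac ` (map ?ab -` P (C A) \<inter> map ?bc -` P (C B))"
      by (intro image_eqI[of _ _ t] IntI vimageI2) simp_all
    moreover have "x \<noteq> [] \<longrightarrow> last x \<noteq> [None, None]"
      using last_convolution2 x by blast
    ultimately show "x \<in> strip_right [None, None]
        (map ?ac ` (map ?ab -` P (C A) \<inter> map ?bc -` P (C B)))"
      unfolding strip_right_def by (intro CollectI conjI exI)
  next
    fix x assume "x \<in> strip_right [None, None]
        (map ?ac ` (map ?ab -` P (C A) \<inter> map ?bc -` P (C B)))"
    then obtain k t where last_x: "x \<noteq> [] \<longrightarrow> last x \<noteq> [None, None]"
      and xt: "x @ replicate k [None, None] = map ?ac t"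
      and tA: "map ?ab t \<in> P (C A)" and tB: "map ?bc t \<in> P (C B)"
      unfolding strip_right_def by auto
    from tA[unfolded P_iff] obtain u v
      where uv: "(u, v) \<in> A" and len: "length u \<le> length t" "length v \<le> length t"
        and ab: "map ?ab t = map (\<lambda>k. [padded_nth u k, padded_nth v k]) [0..<length t]"
      by auto
    from tB[unfolded P_iff] obtain v' w
      where vw: "(v', w) \<in> B" and len': "length v' \<le> length t" "length w \<le> length t"
        and bc: "map ?bc t = map (\<lambda>k. [padded_nth v' k, padded_nth w k]) [0..<length t]"
      by auto
    have ab_nth: "?ab (t ! i) = [padded_nth u i, padded_nth v i]" if "i < length t" for i
      using arg_cong[OF ab, of "\<lambda>xs. xs ! i"] that by simp
    have bc_nth: "?bc (t ! i) = [padded_nth v' i, padded_nth w i]" if "i < length t" for i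
      using arg_cong[OF bc, of "\<lambda>xs. xs ! i"] that by simp
    \<comment> \<open>Below \<open>length t\<close> both sides are the middle component of
      \<open>t ! i\<close>; from there on both are \<open>None\<close>. Hence the two factors share
      their middle string.\<close>
    have "padded_nth v i = padded_nth v' i" for i
      using ab_nth[of i] bc_nth[of i] len len' by (cases "i < length t"; cases "t ! i") simp_all
    then have "v = v'" by (rule padded_nth_inject)
    have "map ?ac t = map (\<lambda>k. [padded_nth u k, padded_nth w k]) [0..<length t]"
    proof (rule nth_equalityI)
      fix i assume "i < length (map ?ac t)"
      then show "map ?ac t ! i = map (\<lambda>k. [padded_nth u k, padded_nth w k]) [0..<length t] ! i"
        using ab_nth[of i] bc_nth[of i] by (cases "t ! i") simp_all
    qed simp
    then have "x @ replicate k [None, None] = convolution [u, w] @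
        replicate (length t - max (length u) (length w)) [None, None]"
      using convolution2_pad[of u w "length t"] len len' xt by simp
    then have "x = convolution [u, w]"
      by (rule append_replicate_inject) (use last_x last_convolution2[of u w] in auto)
    moreover have "(u, w) \<in> A O B"
      using uv vw \<open>v = v'\<close> by blast
    ultimately show "x \<in> C (A O B)"
      unfolding C_def by (intro image_eqI[of _ _ "(u, w)"]) simp_all
  qed
qed

section \<open>FA recognizable binary relations\<close>

text \<open>Sets of pairs replace sets of two-element lists, so that \<open>O\<close> and converse
  apply directly.\<close>

definition FA_rel :: "'a set \<Rightarrow> ('a list \<times> 'a list) set \<Rightarrow> bool" where
  "FA_rel \<Sigma> A \<longleftrightarrow> A \<subseteq> lists \<Sigma> \<times> lists \<Sigma> \<and> finite_quotients ((\<lambda>(u, v). convolution [u, v]) ` A)"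

lemma finite_tuples: "finite A \<Longrightarrow> finite (tuples n A)"
  unfolding tuples_def using finite_lists_length_eq[of A n]
  by (simp add: in_lists_conv_set subset_eq conj_commute Ball_def)

text \<open>Convolutions of strings over \<open>\<Sigma>\<close> lie over the finite alphabet of
  padded pairs, so regularity reduces to having finitely many quotients.\<close>

lemma FA_recognizable_iff_FA_rel:
  assumes "finite \<Sigma>"
  shows "FA_recognizable 2 \<Sigma> {[u, v] | u v. (u, v) \<in> A} \<longleftrightarrow> FA_rel \<Sigma> A"
proof -
  let ?A = "{[u, v] | u v. (u, v) \<in> A}"
  have img: "convolution ` ?A = (\<lambda>(u, v). convolution [u, v]) ` A"
    by force
  have sub: "?A \<subseteq> tuples 2 (lists \<Sigma>) \<longleftrightarrow> A \<subseteq> lists \<Sigma> \<times> lists \<Sigma>"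
  proof -
    have "[u, v] \<in> tuples 2 (lists \<Sigma>) \<longleftrightarrow> u \<in> lists \<Sigma> \<and> v \<in> lists \<Sigma>" for u v
      by (simp add: tuples_def)
    moreover have "?A = (\<lambda>p. [fst p, snd p]) ` A" by force
    ultimately show ?thesis
      by (simp add: image_subset_iff subset_iff[of A] Ball_def split_paired_All
          del: in_lists_conv_set)
  qed
  have fin: "finite (tuples 2 (insert None (Some ` \<Sigma>)))"
    using assms by (simp add: finite_tuples)
  have "(\<lambda>(u, v). convolution [u, v]) ` A \<subseteq> lists (tuples 2 (insert None (Some ` \<Sigma>)))"
    if "A \<subseteq> lists \<Sigma> \<times> lists \<Sigma>"
  proof (rule image_subsetI)
    fix p assume "p \<in> A"
    with that have "fst p \<in> lists \<Sigma>" "snd p \<in> lists \<Sigma>" by auto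
    then show "(case p of (u, v) \<Rightarrow> convolution [u, v])
        \<in> lists (tuples 2 (insert None (Some ` \<Sigma>)))"
      unfolding case_prod_unfold by (rule convolution2_in_lists)
  qed
  then show ?thesis
    unfolding FA_recognizable_def img sub FA_rel_def regular_iff_finite_quotients[OF fin] by blast
qed

lemma FA_rel_Id_on:
  assumes "R \<subseteq> lists \<Sigma>" "finite_quotients R"
  shows "FA_rel \<Sigma> (Id_on R)"
proof -
  have "(\<lambda>(u, v). convolution [u, v]) ` Id_on R = map (\<lambda>a. [Some a, Some a]) ` R"
    by (force simp: convolution2_diag Id_on_def)
  then show ?thesis
    using assms finite_quotients_map_image[OF assms(2), of "\<lambda>a. [Some a, Some a]"]
    by (auto simp: FA_rel_def)
qed

lemma FA_rel_converse:
  assumes "FA_rel \<Sigma> A"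
  shows "FA_rel \<Sigma> (A\<inverse>)"
proof -
  let ?c = "\<lambda>(u, v). convolution [u, v]"
  have "A\<inverse> = prod.swap ` A"
    by (auto intro: rev_image_eqI)
  then have "?c ` (A\<inverse>) = map rev ` ?c ` A"
    by (simp add: image_image case_prod_unfold convolution2_swap[symmetric])
  then show ?thesis
    using assms finite_quotients_map_image[of "?c ` A" rev] by (auto simp: FA_rel_def)
qed

lemma FA_rel_relcomp:
  assumes "FA_rel \<Sigma> A" "FA_rel \<Sigma> B"
  shows "FA_rel \<Sigma> (A O B)"
proof -
  have "A O B \<subseteq> lists \<Sigma> \<times> lists \<Sigma>"
    using assms unfolding FA_rel_def by blast
  then show ?thesis
    using assms unfolding FA_rel_def convolution_relcomp
    by (simp add: finite_quotients_strip_right finite_quotients_map_image finite_quotients_Int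
        finite_quotients_map_vimage finite_quotients_pad_right)
qed

lemma FA_rel_UN:
  assumes "finite I" "\<And>i. i \<in> I \<Longrightarrow> FA_rel \<Sigma> (A i)"
  shows "FA_rel \<Sigma> (\<Union>i\<in>I. A i)"
proof -
  have "finite_quotients (\<Union>i\<in>I. (\<lambda>(u, v). convolution [u, v]) ` A i)"
    using assms by (intro finite_quotients_UN) (simp_all add: FA_rel_def)
  moreover have "(\<Union>i\<in>I. A i) \<subseteq> lists \<Sigma> \<times> lists \<Sigma>"
    using assms(2) unfolding FA_rel_def by (intro UN_least) blast
  ultimately show ?thesis
    by (simp add: FA_rel_def image_UN)
qed

text \<open>Both tracks start at the same position, so one letter in front of each string puts the
  single symbol \<open>[Some a, Some b]\<close> in front of the convolution.\<close>

lemma FA_rel_Cons: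
  assumes "FA_rel \<Sigma> A" "\<Sigma> \<subseteq> \<Sigma>'" "a \<in> \<Sigma>'" "b \<in> \<Sigma>'"
  shows "FA_rel \<Sigma>' ((\<lambda>(u, v). (a # u, b # v)) ` A)"
proof -
  let ?c = "\<lambda>(u, v). convolution [u, v]"
  have "?c ` (\<lambda>(u, v). (a # u, b # v)) ` A = (#) [Some a, Some b] ` ?c ` A"
    by (simp add: image_image case_prod_unfold convolution2_Cons)
  then have "finite_quotients (?c ` (\<lambda>(u, v). (a # u, b # v)) ` A)"
    using assms(1) by (simp add: FA_rel_def finite_quotients_Cons)
  moreover have "A \<subseteq> lists \<Sigma>' \<times> lists \<Sigma>'"
    using assms(1) lists_mono[OF assms(2)] unfolding FA_rel_def by blast
  then have "(\<lambda>(u, v). (a # u, b # v)) ` A \<subseteq> lists \<Sigma>' \<times> lists \<Sigma>'"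
  proof (intro image_subsetI)
    fix p assume "p \<in> A"
    with \<open>A \<subseteq> _\<close> have "fst p \<in> lists \<Sigma>'" "snd p \<in> lists \<Sigma>'" by auto
    then show "(case p of (u, v) \<Rightarrow> (a # u, b # v)) \<in> lists \<Sigma>' \<times> lists \<Sigma>'"
      using assms(3,4) by (simp add: case_prod_unfold)
  qed
  ultimately show ?thesis unfolding FA_rel_def by blast
qed

section \<open>Right multiplication in graph automatic groups\<close>

definition mult_rel ::
    "('g, 'm) monoid_scheme \<Rightarrow> 'w set \<Rightarrow> ('w \<Rightarrow> 'g) \<Rightarrow> 'g \<Rightarrow> ('w \<times> 'w) set" where
  "mult_rel G R \<nu> g = {(u, v). u \<in> R \<and> v \<in> R \<and> \<nu> u \<otimes>\<^bsub>G\<^esub> g = \<nu> v}"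

lemma FA_recognizable_cayley_edges:
  assumes "finite \<Sigma>" "bij_betw \<nu> R (carrier G)"
  shows "FA_recognizable 2 \<Sigma>
      {[u, v] | u v. u \<in> R \<and> v \<in> R \<and> (\<nu> u, \<nu> v) \<in> cayley_edges G x} \<longleftrightarrow>
    FA_rel \<Sigma> (mult_rel G R \<nu> x)"
proof -
  have "{[u, v] | u v. u \<in> R \<and> v \<in> R \<and> (\<nu> u, \<nu> v) \<in> cayley_edges G x} =
      {[u, v] | u v. (u, v) \<in> mult_rel G R \<nu> x}"
    using assms(2) by (auto simp: cayley_edges_def mult_rel_def bij_betw_def)
  then show ?thesis by (simp add: FA_recognizable_iff_FA_rel[OF assms(1)])
qed

context group
begin

lemma mult_rel_one:
  assumes "bij_betw \<nu> R (carrier G)"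
  shows "mult_rel G R \<nu> \<one> = Id_on R"
proof -
  have "\<nu> u \<in> carrier G" if "u \<in> R" for u
    using assms that by (auto simp: bij_betw_def)
  moreover have "u = v" if "\<nu> u = \<nu> v" "u \<in> R" "v \<in> R" for u v
    using assms that by (auto simp: bij_betw_def dest: inj_onD)
  ultimately show ?thesis
    by (auto simp: mult_rel_def Id_on_iff)
qed

lemma mult_rel_inv:
  assumes "bij_betw \<nu> R (carrier G)" "g \<in> carrier G"
  shows "mult_rel G R \<nu> (inv g) = (mult_rel G R \<nu> g)\<inverse>"
proof -
  have "\<nu> u \<in> carrier G" if "u \<in> R" for u
    using assms that by (auto simp: bij_betw_def)
  then show ?thesis
    using assms(2) by (auto simp: mult_rel_def m_assoc) (metis m_assoc inv_closed l_inv r_one r_inv)+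
qed

lemma mult_rel_mult:
  assumes "bij_betw \<nu> R (carrier G)" "g \<in> carrier G" "h \<in> carrier G"
  shows "mult_rel G R \<nu> (g \<otimes> h) = mult_rel G R \<nu> g O mult_rel G R \<nu> h"
proof -
  have \<nu>: "\<nu> u \<in> carrier G" if "u \<in> R" for u
    using assms that by (auto simp: bij_betw_def)
  have surj: "\<exists>u\<in>R. \<nu> u = x" if "x \<in> carrier G" for x
    using assms(1) that unfolding bij_betw_def by (metis imageE)
  have "(u, w) \<in> mult_rel G R \<nu> g O mult_rel G R \<nu> h"
    if "(u, w) \<in> mult_rel G R \<nu> (g \<otimes> h)" for u w
  proof -
    from that have u: "u \<in> R" "w \<in> R" "\<nu> u \<otimes> (g \<otimes> h) = \<nu> w"
      by (auto simp: mult_rel_def)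
    \<comment> \<open>Surjectivity of \<open>\<nu>\<close> supplies a code for the intermediate
      product.\<close>
    obtain v where "v \<in> R" "\<nu> v = \<nu> u \<otimes> g"
      using surj[of "\<nu> u \<otimes> g"] \<nu>[OF u(1)] assms by auto
    then show ?thesis
      using u \<nu> assms(2,3) by (auto simp: mult_rel_def m_assoc intro!: relcompI[of _ v])
  qed
  moreover have "mult_rel G R \<nu> g O mult_rel G R \<nu> h \<subseteq> mult_rel G R \<nu> (g \<otimes> h)"
    using \<nu> assms(2,3) by (auto simp: mult_rel_def simp flip: m_assoc)
  ultimately show ?thesis by auto
qed

text \<open>Induction on \<open>generate\<close>: the unit gives the identity relation, inverses
  give converses, and products give compositions.\<close>

lemma FA_rel_mult_rel:
  assumes "bij_betw \<nu> R (carrier G)" "R \<subseteq> lists \<Sigma>" "finite_quotients R"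
    and "X \<subseteq> carrier G" "\<And>x. x \<in> X \<Longrightarrow> FA_rel \<Sigma> (mult_rel G R \<nu> x)"
    and "g \<in> generate G X"
  shows "FA_rel \<Sigma> (mult_rel G R \<nu> g)"
  using assms(6)
proof (induction rule: generate.induct)
  case one
  then show ?case using assms by (simp add: mult_rel_one FA_rel_Id_on)
next
  case (incl h)
  then show ?case by (rule assms(5))
next
  case (inv h)
  then show ?case using assms mult_rel_inv[OF assms(1)] FA_rel_converse by (metis subsetD)
next
  case (eng g h)
  moreover have "g \<in> carrier G" "h \<in> carrier G"
    using eng.hyps assms(4) generate_in_carrier by blast+
  ultimately show ?case using assms(1) by (simp add: mult_rel_mult FA_rel_relcomp)
qed

end

section \<open>Finite extensions\<close>

text \<open>The right cosets are numbered by \<open>c\<close> and \<open>k i\<close> is picked from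
  the coset \<open>c i\<close>. The indices are natural numbers so that they can later serve as
  letters.\<close>

lemma (in group) right_transversal:
  assumes "subgroup H G" "finite (rcosets H)"
  obtains n :: nat and k :: "nat \<Rightarrow> 'a"
  where "k ` {..<n} \<subseteq> carrier G"
    and "bij_betw (\<lambda>(h, i). h \<otimes> k i) (H \<times> {..<n}) (carrier G)"
proof -
  interpret H: subgroup H G by fact
  obtain c where c: "bij_betw c {0..<card (rcosets H)} (rcosets H)"
    using ex_bij_betw_nat_finite[OF assms(2)] by blast
  define n where "n = card (rcosets H)"
  have "c i \<in> rcosets H" if "i < n" for i
    using c that by (auto simp: bij_betw_def n_def)
  then have "\<exists>x\<in>carrier G. c i = H #> x" if "i < n" for i
    using that unfolding RCOSETS_def by blast
  then obtain k where k: "\<And>i. i < n \<Longrightarrow> k i \<in> carrier G" "\<And>i. i < n \<Longrightarrow> c i = H #> k i"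
    by metis
  have surj: "\<exists>h\<in>H. \<exists>i<n. g = h \<otimes> k i" if "g \<in> carrier G" for g
  proof -
    have "H #> g \<in> rcosets H"
      using that by (auto simp: RCOSETS_def)
    then obtain i where "i < n" "c i = H #> g"
      using c unfolding bij_betw_def n_def by (metis imageE atLeastLessThan_iff)
    then have "g \<in> H #> k i"
      using k that assms(1) rcos_self by metis
    then show ?thesis using \<open>i < n\<close> by (auto simp: r_coset_def)
  qed
  have inj: "h = h' \<and> i = j"
    if "h \<in> H" "h' \<in> H" "i < n" "j < n" "h \<otimes> k i = h' \<otimes> k j" for h h' i j
  proof -
    \<comment> \<open>A left factor from \<open>H\<close> does not change the right coset, so equal
      products lie in equal cosets. Injectivity of \<open>c\<close> then gives \<open>i = j\<close>,
      and cancelling \<open>k i\<close> gives \<open>h = h'\<close>.\<close>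
    have "H #> k i = H #> (h \<otimes> k i)" "H #> k j = H #> (h' \<otimes> k j)"
      using that k coset_mult_assoc[of H] coset_join2[of _ H] assms(1) H.subset
      by (metis H.mem_carrier)+
    then have "c i = c j" using that k by simp
    then have "i = j"
      using c that unfolding bij_betw_def n_def by (auto dest: inj_onD)
    then show ?thesis using that k by (metis H.mem_carrier right_cancel)
  qed
  show thesis
  proof (rule that[of k n])
    show "k ` {..<n} \<subseteq> carrier G" using k(1) by auto
    show "bij_betw (\<lambda>(h, i). h \<otimes> k i) (H \<times> {..<n}) (carrier G)"
    proof (rule bij_betw_imageI)
      show "inj_on (\<lambda>(h, i). h \<otimes> k i) (H \<times> {..<n})"
        by (rule inj_onI) (use inj in auto)
      show "(\<lambda>(h, i). h \<otimes> k i) ` (H \<times> {..<n}) = carrier G"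
        using surj k(1) H.subset by (force simp: image_iff)
    qed
  qed
qed

theorem theorem10p1:
  fixes G :: "('g, 'm) monoid_scheme" and H :: "'g set"
  assumes "group G"
    and "H \<lhd> G"
    and "finite (carrier (G Mod H))"
    and "graph_automatic (G\<lparr>carrier := H\<rparr>)"
  shows "graph_automatic G"
proof -
  interpret group G by fact
  interpret H: normal H G by fact
  let ?H = "G\<lparr>carrier := H\<rparr>"
  have sub: "subgroup H G" by (rule H.is_subgroup)
  interpret HG: group ?H by (rule subgroup_imp_group[OF sub])
  obtain X and \<Sigma> :: "nat set" and R \<nu> where finX: "finite X" and XH: "X \<subseteq> H"
    and genX: "generate ?H X = H" and fin\<Sigma>: "finite \<Sigma>" and reg: "regular \<Sigma> R"
    and bij: "bij_betw \<nu> R H"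
    and rec: "\<And>x. x \<in> X \<Longrightarrow> FA_recognizable 2 \<Sigma>
      {[u, v] | u v. u \<in> R \<and> v \<in> R \<and> (\<nu> u, \<nu> v) \<in> cayley_edges ?H x}"
    using assms(4) by (auto simp: graph_automatic_def graph_automatic_wrt_def
        finite_generating_set_def)
  have R: "R \<subseteq> lists \<Sigma>" "finite_quotients R"
    using reg fin\<Sigma> by (auto simp: regular_iff_finite_quotients)
  have \<nu>H: "\<nu> u \<in> H" if "u \<in> R" for u
    using bij that by (auto simp: bij_betw_def)
  \<comment> \<open>Since \<open>X\<close> generates \<open>H\<close>, recognizability passes from
    the generators to every element of \<open>H\<close>; the multipliers \<open>h i\<close> below
    need not lie in \<open>X\<close>.\<close>
  have multH: "FA_rel \<Sigma> (mult_rel ?H R \<nu> h)" if "h \<in> H" for h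
    using HG.FA_rel_mult_rel[of \<nu> R \<Sigma> X h] bij R XH rec genX that
      FA_recognizable_cayley_edges[OF fin\<Sigma>, of \<nu> R ?H] by auto
  \<comment> \<open>The carrier of the quotient group is the set of right cosets.\<close>
  have "finite (rcosets\<^bsub>G\<^esub> H)"
    using assms(3) by (simp add: FactGroup_def)
  then obtain n :: nat and k :: "nat \<Rightarrow> 'g" where kc: "k ` {..<n} \<subseteq> carrier G"
    and bijk: "bij_betw (\<lambda>(h, i). h \<otimes>\<^bsub>G\<^esub> k i) (H \<times> {..<n}) (carrier G)"
    by (rule right_transversal[OF sub])
  have k: "k i \<in> carrier G" if "i < n" for i
    using kc that by auto
  have dec: "\<exists>h\<in>H. \<exists>i<n. g = h \<otimes>\<^bsub>G\<^esub> k i" if "g \<in> carrier G" for g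
    using that unfolding bij_betw_imp_surj_on[OF bijk, symmetric] by auto
  have uniq: "h = h' \<and> i = j"
    if "h \<in> H" "h' \<in> H" "i < n" "j < n" "h \<otimes>\<^bsub>G\<^esub> k i = h' \<otimes>\<^bsub>G\<^esub> k j" for h h' i j
    using inj_onD[OF bij_betw_imp_inj_on[OF bijk], of "(h, i)" "(h', j)"] that by simp

  \<comment> \<open>A finite generating set of \<open>G\<close>\<close>
  define Y where "Y = X \<union> k ` {..<n}"
  have Yc: "Y \<subseteq> carrier G" using XH H.subset k by (auto simp: Y_def)
  have "H \<subseteq> generate G Y"
  proof -
    \<comment> \<open>Generating inside the subgroup \<open>H\<close> and inside \<open>G\<close>
      yields the same set.\<close>
    have "H = generate G X"
      using generate_consistent[OF XH sub] genX by simp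
    then show ?thesis using mono_generate[of X Y] by (auto simp: Y_def)
  qed
  then have "g \<in> generate G Y" if g: "g \<in> carrier G" for g
  proof -
    obtain h i where "h \<in> H" "i < n" "g = h \<otimes>\<^bsub>G\<^esub> k i" using dec[OF g] by blast
    moreover have "k i \<in> generate G Y" if "i < n" for i
      using that by (intro generate.incl) (simp add: Y_def)
    ultimately show ?thesis
      using \<open>H \<subseteq> _\<close> by (auto intro: generate.eng)
  qed
  then have "generate G Y = carrier G"
    using generate_incl[OF Yc] by blast
  then have gen: "finite_generating_set G Y"
    using finX Yc by (simp add: finite_generating_set_def Y_def)

  \<comment> \<open>The encoding of \<open>G\<close>\<close>
  define \<Sigma>' where "\<Sigma>' = \<Sigma> \<union> {..<n}"
  define R' where "R' = (\<Union>i<n. (#) i ` R)"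
  \<comment> \<open>Words of \<open>R'\<close> are nonempty. Index letters may also occur in
    \<open>\<Sigma>\<close>, which causes no ambiguity because only the first letter is read as an
    index.\<close>
  define \<nu>' where "\<nu>' w = \<nu> (tl w) \<otimes>\<^bsub>G\<^esub> k (hd w)" for w
  have fin\<Sigma>': "finite \<Sigma>'" using fin\<Sigma> by (simp add: \<Sigma>'_def)
  have "R \<subseteq> lists \<Sigma>'"
    using R(1) lists_mono[of \<Sigma> \<Sigma>'] by (simp add: \<Sigma>'_def)
  then have "R' \<subseteq> lists \<Sigma>'"
    unfolding R'_def \<Sigma>'_def by (intro UN_least image_subsetI Cons_in_lists_iff[THEN iffD2]) auto
  moreover have "finite_quotients R'"
    unfolding R'_def by (intro finite_quotients_UN finite_quotients_Cons R(2)) simp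
  ultimately have reg': "regular \<Sigma>' R'" by (simp add: regular_iff_finite_quotients fin\<Sigma>')
  have bij': "bij_betw \<nu>' R' (carrier G)"
  proof (rule bij_betw_imageI)
    show "inj_on \<nu>' R'"
    proof (rule inj_onI)
      fix u v assume "u \<in> R'" "v \<in> R'" and eq: "\<nu>' u = \<nu>' v"
      then obtain i a j b where "u = i # a" "v = j # b" "i < n" "j < n" "a \<in> R" "b \<in> R"
        by (auto simp: R'_def)
      then show "u = v"
        using eq uniq[of "\<nu> a" "\<nu> b" i j] \<nu>H bij
        by (auto simp: \<nu>'_def bij_betw_def dest: inj_onD)
    qed
    show "\<nu>' ` R' = carrier G"
    proof (intro equalityI subsetI)
      fix g assume "g \<in> carrier G"
      then obtain h i where hi: "h \<in> H" "i < n" "g = h \<otimes>\<^bsub>G\<^esub> k i" using dec by blast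
      then obtain a where "a \<in> R" "\<nu> a = h" using bij by (auto simp: bij_betw_def)
      then show "g \<in> \<nu>' ` R'"
        using hi by (intro image_eqI[of _ _ "i # a"]) (auto simp: \<nu>'_def R'_def)
    qed (use \<nu>H k H.subset in \<open>auto simp: \<nu>'_def R'_def\<close>)
  qed

  \<comment> \<open>Right multiplication on the new codes\<close>
  have "FA_rel \<Sigma>' (mult_rel G R' \<nu>' y)" if y: "y \<in> carrier G" for y
  proof -
    have "\<exists>h j. h \<in> H \<and> j < n \<and> k i \<otimes>\<^bsub>G\<^esub> y = h \<otimes>\<^bsub>G\<^esub> k j" if "i < n" for i
      using dec[of "k i \<otimes>\<^bsub>G\<^esub> y"] k[OF that] y by blast
    \<comment> \<open>For the fixed \<open>y\<close>, \<open>s i\<close> is the index of the coset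
      containing \<open>k i\<close> times \<open>y\<close>, and \<open>h i\<close> is the
      \<open>H\<close>-part of that product.\<close>
    then obtain h s where h: "\<And>i. i < n \<Longrightarrow> h i \<in> H" and s: "\<And>i. i < n \<Longrightarrow> s i < n"
      and hs: "\<And>i. i < n \<Longrightarrow> k i \<otimes>\<^bsub>G\<^esub> y = h i \<otimes>\<^bsub>G\<^esub> k (s i)"
      by metis
    \<comment> \<open>Associativity moves \<open>h i\<close> next to \<open>\<nu> u\<close>;
      uniqueness of the decomposition then separates the index from the
      \<open>H\<close>-part.\<close>
    have iff: "(\<nu> u \<otimes>\<^bsub>G\<^esub> k i) \<otimes>\<^bsub>G\<^esub> y = \<nu> v \<otimes>\<^bsub>G\<^esub> k j \<longleftrightarrow> j = s i \<and> \<nu> u \<otimes>\<^bsub>G\<^esub> h i = \<nu> v"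
      if "i < n" "j < n" "u \<in> R" "v \<in> R" for i j u v
    proof -
      have "(\<nu> u \<otimes>\<^bsub>G\<^esub> k i) \<otimes>\<^bsub>G\<^esub> y = \<nu> u \<otimes>\<^bsub>G\<^esub> (h i \<otimes>\<^bsub>G\<^esub> k (s i))"
        using that hs[OF that(1)] k \<nu>H y by (simp add: m_assoc)
      also have "\<dots> = (\<nu> u \<otimes>\<^bsub>G\<^esub> h i) \<otimes>\<^bsub>G\<^esub> k (s i)"
        using that h s k \<nu>H by (simp add: m_assoc)
      finally show ?thesis
        using uniq[of "\<nu> u \<otimes>\<^bsub>G\<^esub> h i" "\<nu> v" "s i" j] that h s \<nu>H by auto
    qed
    \<comment> \<open>For each first letter \<open>i\<close> the new first letter is fixed as
      \<open>s i\<close>, and the remaining code undergoes multiplication by \<open>h i\<close>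
      inside \<open>H\<close>.\<close>
    have "mult_rel G R' \<nu>' y =
        (\<Union>i<n. (\<lambda>(u, v). (i # u, s i # v)) ` mult_rel ?H R \<nu> (h i))"
    proof (intro equalityI subsetI)
      fix p assume "p \<in> mult_rel G R' \<nu>' y"
      then obtain i j u v where "i < n" "j < n" "u \<in> R" "v \<in> R" "p = (i # u, j # v)"
        "(\<nu> u \<otimes>\<^bsub>G\<^esub> k i) \<otimes>\<^bsub>G\<^esub> y = \<nu> v \<otimes>\<^bsub>G\<^esub> k j"
        by (auto simp: mult_rel_def R'_def \<nu>'_def)
      then show "p \<in> (\<Union>i<n. (\<lambda>(u, v). (i # u, s i # v)) ` mult_rel ?H R \<nu> (h i))"
        by (auto simp: iff mult_rel_def)
    next
      fix p assume "p \<in> (\<Union>i<n. (\<lambda>(u, v). (i # u, s i # v)) ` mult_rel ?H R \<nu> (h i))"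
      then obtain i u v where "i < n" "u \<in> R" "v \<in> R" "p = (i # u, s i # v)"
        "\<nu> u \<otimes>\<^bsub>G\<^esub> h i = \<nu> v"
        by (auto simp: mult_rel_def)
      then show "p \<in> mult_rel G R' \<nu>' y"
        using iff[of i "s i" u v] s by (auto simp: mult_rel_def R'_def \<nu>'_def)
    qed
    moreover have "FA_rel \<Sigma>' ((\<lambda>(u, v). (i # u, s i # v)) ` mult_rel ?H R \<nu> (h i))"
      if "i < n" for i
      using that h s by (intro FA_rel_Cons[OF multH]) (auto simp: \<Sigma>'_def)
    ultimately show ?thesis
      by (simp only:) (rule FA_rel_UN, simp_all only: finite_lessThan lessThan_iff)
  qed
  then have "\<forall>y\<in>Y. FA_recognizable 2 \<Sigma>'
      {[u, v] | u v. u \<in> R' \<and> v \<in> R' \<and> (\<nu>' u, \<nu>' v) \<in> cayley_edges G y}"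
    unfolding FA_recognizable_cayley_edges[OF fin\<Sigma>' bij'] using Yc by blast
  then show ?thesis
    unfolding graph_automatic_def graph_automatic_wrt_def
    using assms(1) gen fin\<Sigma>' reg' bij' by (intro exI conjI)
qed

end
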